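(* Let $a<b$, let $g$ be continuous on $[a,b]$ and $k$ continuous on $[a,b]\times[a,b]$, let $N$ be a positive integer, $h>0$, $n=2N+1$. Suppose the linear systems $$(I_n-V_n^{SE})\,\mathbf{u}_n=\mathbf{g}_n,\qquad (E_n^{RZ}-V_n^{RZ})\,\mathbf{c}_n=\mathbf{g}_n$$ are uniquely solvable, with solutions $\mathbf{u}_n=(u_{-N},\dots,u_N)^{\mathrm T}$ and $\mathbf{c}_n=(c_{-N},\dots,c_N)^{\mathrm T}$. Define, for $t\in[a,b]$, $$v_N^{SE}(t)=u_{-N}\,\omega_a(t)+u_N\,\omega_b(t)+\sum_{j=-N}^{N}\{u_j-u_{-N}\,\omega_a(t_j)-u_N\,\omega_b(t_j)\}\,S(j,h)(\phi(t)),$$ $$w_N^{RZ}(t)=c_{-N}\,\omega_a(t)+\sum_{j=-N+1}^{N-1}c_j\,S(j,h)(\phi(t))+c_N\,\omega_b(t).$$ Then $$v_N^{SE}(t_i)=w_N^{RZ}(t_i),\qquad i=-N,-N+1,\dots,N,$$ but in general $v_N^{SE}\neq w_N^{RZ}$ (that is, it is not true that $v_N^{SE}=w_N^{RZ}$ as functions on $[a,b]$ for all such data).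
   Context: Variable transformation: $\psi(x)=\frac{b-a}{2}\tanh\left(\frac{x}{2}\right)+\frac{b+a}{2}$ maps $\mathbb{R}$ onto $(a,b)$; $\phi=\psi^{-1}$; $t_j=\psi(jh)$. Basis functions: $S(j,h)(x)=\frac{\sin(\pi(x-jh)/h)}{\pi(x-jh)/h}$ for $x\ne jh$, $S(j,h)(jh)=1$; $J(j,h)(x)=h\left\{\frac12+\frac1\pi\mathrm{Si}\left[\frac{\pi(x-jh)}{h}\right]\right\}$ with $\mathrm{Si}(x)=\int_0^x\frac{\sin t}{t}\,dt$. Compositions with $\phi$ are extended to $t=a,b$ by their limits. Auxiliary functions: $\omega_a(t)=\frac{b-t}{b-a}$, $\omega_b(t)=\frac{t-a}{b-a}$. Discrete Volterra operator: $\mathcal{V}_N[f](t)=\sum_{j=-N}^N k(t,t_j)f(t_j)\psi'(jh)J(j,h)(\phi(t))$. Matrices and vectors (rows and columns indexed by $i,j=-N,\dots,N$): $I_n$ is the identity matrix; $\mathbf{g}_n=(g(t_{-N}),\dots,g(t_N))^{\mathrm T}$; $(V_n^{SE})_{ij}=k(t_i,t_j)\psi'(jh)\,h\,\delta^{(-1)}_{i-j}$, where $\delta^{(-1)}_m=\frac12+\frac1\pi\mathrm{Si}(\pi m)$. The matrix $E_n^{RZ}$ has column $j=-N$ equal to $(\omega_a(t_i))_i$, column $j=N$ equal to $(\omega_b(t_i))_i$, and entries $\delta_{ij}$ (Kronecker delta) in columns $-N+1\le j\le N-1$. The matrix $V_n^{RZ}$ has column $j=-N$ equal to $(\mathcal{V}_N[\omega_a](t_i))_i$,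 column $j=N$ equal to $(\mathcal{V}_N[\omega_b](t_i))_i$, and entries $k(t_i,t_j)\psi'(jh)\,h\,\delta^{(-1)}_{i-j}$ in columns $-N+1\le j\le N-1$. *)

theory Defs
  imports "HOL-Probability.Sinc_Integral" "Jordan_Normal_Form.Matrix"
begin

subsection \<open>Variable transformation and basis functions\<close>

definition psi :: "real \<Rightarrow> real \<Rightarrow> real \<Rightarrow> real" where
  "psi a b x = (b - a) / 2 * tanh (x / 2) + (b + a) / 2"

definition phi :: "real \<Rightarrow> real \<Rightarrow> real \<Rightarrow> real" where
  "phi a b = inv_into UNIV (psi a b)"

definition node :: "real \<Rightarrow> real \<Rightarrow> real \<Rightarrow> int \<Rightarrow> real" where
  "node a b h j = psi a b (of_int j * h)"

definition sinc_basis :: "int \<Rightarrow> real \<Rightarrow> real \<Rightarrow> real" where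
  "sinc_basis j h x =
     (if x = of_int j * h then 1
      else sin (pi * (x - of_int j * h) / h) / (pi * (x - of_int j * h) / h))"

definition sinc_int_basis :: "int \<Rightarrow> real \<Rightarrow> real \<Rightarrow> real" where
  "sinc_int_basis j h x = h * (1/2 + 1/pi * Si (pi * (x - of_int j * h) / h))"

text \<open>
  The composition of \<open>F\<close> with \<open>phi a b\<close>. Since \<open>phi a b\<close> is the inverse of \<open>psi a b\<close> only on
  the open interval, the values at the endpoints \<open>a\<close> and \<open>b\<close> are the one-sided limits.
\<close>

definition comp_phi :: "real \<Rightarrow> real \<Rightarrow> (real \<Rightarrow> real) \<Rightarrow> real \<Rightarrow> real" where
  "comp_phi a b F t =
     (if t = a then Lim (at_right a) (\<lambda>s. F (phi a b s))
      else if t = b then Lim (at_left b) (\<lambda>s. F (phi a b s))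
      else F (phi a b t))"

definition omega_a :: "real \<Rightarrow> real \<Rightarrow> real \<Rightarrow> real" where
  "omega_a a b t = (b - t) / (b - a)"

definition omega_b :: "real \<Rightarrow> real \<Rightarrow> real \<Rightarrow> real" where
  "omega_b a b t = (t - a) / (b - a)"

definition volterra ::
  "real \<Rightarrow> real \<Rightarrow> (real \<Rightarrow> real \<Rightarrow> real) \<Rightarrow> nat \<Rightarrow> real \<Rightarrow> (real \<Rightarrow> real) \<Rightarrow> real \<Rightarrow> real" where
  "volterra a b k N h f t =
     (\<Sum>j\<in>{- int N..int N}. k t (node a b h j) * f (node a b h j)
        * deriv (psi a b) (of_int j * h) * comp_phi a b (sinc_int_basis j h) t)"

subsection \<open>Matrices and vectors\<close>

text \<open>
  Rows and columns are numbered by \<open>-N, \<dots>, N\<close>; the library numbers them by \<open>0, \<dots>, 2 N\<close>.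
  The index \<open>i\<close> is therefore stored at position \<open>i + N\<close>.
\<close>

definition sym_mat :: "nat \<Rightarrow> (int \<Rightarrow> int \<Rightarrow> real) \<Rightarrow> real Matrix.mat" where
  "sym_mat N A = Matrix.mat (2*N+1) (2*N+1) (\<lambda>(p, q). A (int p - int N) (int q - int N))"

definition sym_vec :: "nat \<Rightarrow> (int \<Rightarrow> real) \<Rightarrow> real Matrix.vec" where
  "sym_vec N x = Matrix.vec (2*N+1) (\<lambda>p. x (int p - int N))"

definition entry :: "nat \<Rightarrow> real Matrix.vec \<Rightarrow> int \<Rightarrow> real" where
  "entry N x i = vec_index x (nat (i + int N))"

definition delta_int :: "int \<Rightarrow> real" where
  "delta_int m = 1/2 + 1/pi * Si (pi * of_int m)"

definition g_vec :: "real \<Rightarrow> real \<Rightarrow> (real \<Rightarrow> real) \<Rightarrow> nat \<Rightarrow> real \<Rightarrow> real Matrix.vec" where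
  "g_vec a b g N h = sym_vec N (\<lambda>i. g (node a b h i))"

definition V_SE ::
  "real \<Rightarrow> real \<Rightarrow> (real \<Rightarrow> real \<Rightarrow> real) \<Rightarrow> nat \<Rightarrow> real \<Rightarrow> real Matrix.mat" where
  "V_SE a b k N h = sym_mat N (\<lambda>i j.
     k (node a b h i) (node a b h j) * deriv (psi a b) (of_int j * h) * h * delta_int (i - j))"

definition E_RZ :: "real \<Rightarrow> real \<Rightarrow> nat \<Rightarrow> real \<Rightarrow> real Matrix.mat" where
  "E_RZ a b N h = sym_mat N (\<lambda>i j.
     if j = - int N then omega_a a b (node a b h i)
     else if j = int N then omega_b a b (node a b h i)
     else if i = j then 1 else 0)"

definition V_RZ ::
  "real \<Rightarrow> real \<Rightarrow> (real \<Rightarrow> real \<Rightarrow> real) \<Rightarrow> nat \<Rightarrow> real \<Rightarrow> real Matrix.mat" where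
  "V_RZ a b k N h = sym_mat N (\<lambda>i j.
     if j = - int N then volterra a b k N h (omega_a a b) (node a b h i)
     else if j = int N then volterra a b k N h (omega_b a b) (node a b h i)
     else k (node a b h i) (node a b h j) * deriv (psi a b) (of_int j * h) * h * delta_int (i - j))"

definition uniquely_solved_by ::
  "real Matrix.mat \<Rightarrow> real Matrix.vec \<Rightarrow> real Matrix.vec \<Rightarrow> bool" where
  "uniquely_solved_by A y x \<longleftrightarrow>
     x \<in> carrier_vec (dim_col A) \<and> A *\<^sub>v x = y \<and>
     (\<forall>x'\<in>carrier_vec (dim_col A). A *\<^sub>v x' = y \<longrightarrow> x' = x)"

subsection \<open>The two approximate solutions\<close>

definition v_SE :: "real \<Rightarrow> real \<Rightarrow> nat \<Rightarrow> real \<Rightarrow> real Matrix.vec \<Rightarrow> real \<Rightarrow> real" where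
  "v_SE a b N h u t =
     entry N u (- int N) * omega_a a b t + entry N u (int N) * omega_b a b t
     + (\<Sum>j\<in>{- int N..int N}.
          (entry N u j - entry N u (- int N) * omega_a a b (node a b h j)
             - entry N u (int N) * omega_b a b (node a b h j))
          * comp_phi a b (sinc_basis j h) t)"

definition w_RZ :: "real \<Rightarrow> real \<Rightarrow> nat \<Rightarrow> real \<Rightarrow> real Matrix.vec \<Rightarrow> real \<Rightarrow> real" where
  "w_RZ a b N h c t =
     entry N c (- int N) * omega_a a b t
     + (\<Sum>j\<in>{- int N + 1..int N - 1}. entry N c j * comp_phi a b (sinc_basis j h) t)
     + entry N c (int N) * omega_b a b t"

definition admissible ::
  "real \<Rightarrow> real \<Rightarrow> (real \<Rightarrow> real) \<Rightarrow> (real \<Rightarrow> real \<Rightarrow> real) \<Rightarrow> nat \<Rightarrow> real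
     \<Rightarrow> real Matrix.vec \<Rightarrow> real Matrix.vec \<Rightarrow> bool" where
  "admissible a b g k N h u c \<longleftrightarrow>
     a < b \<and> continuous_on {a..b} g \<and> continuous_on ({a..b} \<times> {a..b}) (\<lambda>(s, t). k s t) \<and>
     N > 0 \<and> h > 0 \<and>
     uniquely_solved_by (1\<^sub>m (2*N+1) - V_SE a b k N h) (g_vec a b g N h) u \<and>
     uniquely_solved_by (E_RZ a b N h - V_RZ a b k N h) (g_vec a b g N h) c"

end

theory Submission
  imports Defs
begin

text \<open>
  The values of both approximations at the nodes \<open>t\<^sub>i\<close> solve one and the same uniquely solvable linear
  system. Put \<open>d\<^sub>i = w(t\<^sub>i)\<close>. Since \<open>S(j,h)(ih)\<close> is the Kronecker delta, the
  vector \<open>d\<close> is \<open>E\<^sup>R\<^sup>Z c\<close> (\<open>E_RZ_mult_vec\<close>). Since \<open>J(j,h)(ih) = h \<delta>\<^sup>(\<^sup>-\<^sup>1\<^sup>)\<^sub>i\<^sub>-\<^sub>j\<close>, the discrete Volterra operator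
  acts on nodal values through the matrix \<open>V\<^sup>S\<^sup>E\<close>, so that \<open>V\<^sup>R\<^sup>Z c = V\<^sup>S\<^sup>E d\<close> (\<open>V_RZ_mult_vec\<close>). Hence
  \<open>(I - V\<^sup>S\<^sup>E) d = (E\<^sup>R\<^sup>Z - V\<^sup>R\<^sup>Z) c = g\<close>, and \<open>d = u\<close> by unique solvability. As \<open>v\<close> interpolates \<open>u\<close>
  at the nodes (\<open>v_SE_node\<close>), the two functions agree there.

  They may differ elsewhere because the sinc functions tend to zero at the endpoints: at
  \<open>t = a\<close> the function \<open>v\<close> takes the value \<open>u\<^sub>-\<^sub>N = v(t\<^sub>-\<^sub>N)\<close>, which is a nodal value, whereas \<open>w\<close>
  takes the value \<open>c\<^sub>-\<^sub>N\<close> of its affine part. For \<open>k = 0\<close> and \<open>g = \<omega>\<^sub>a\<close> the affine part reproduces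
  \<open>g\<close>, so that \<open>c\<^sub>-\<^sub>N = \<omega>\<^sub>a(a) = 1\<close>, while \<open>u\<^sub>-\<^sub>N = \<omega>\<^sub>a(t\<^sub>-\<^sub>N) < 1\<close>.
\<close>

section \<open>The variable transformation\<close>

lemma psi_less_iff: "a < b \<Longrightarrow> psi a b x < psi a b y \<longleftrightarrow> x < y"
  by (simp add: psi_def)

lemma psi_eq_iff: "a < b \<Longrightarrow> psi a b x = psi a b y \<longleftrightarrow> x = y"
  by (simp add: psi_def)

lemma psi_bounds:
  assumes "a < b"
  shows "a < psi a b x" "psi a b x < b"
proof -
  have "(b - a) / 2 * (-1) < (b - a) / 2 * tanh (x / 2)"
    by (rule mult_strict_left_mono[OF tanh_real_gt_neg1]) (use assms in simp)
  then show "a < psi a b x" by (simp add: psi_def field_simps)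
  have "(b - a) / 2 * tanh (x / 2) < (b - a) / 2 * 1"
    by (rule mult_strict_left_mono[OF tanh_real_lt_1]) (use assms in simp)
  then show "psi a b x < b" by (simp add: psi_def field_simps)
qed

lemma phi_psi: "a < b \<Longrightarrow> phi a b (psi a b x) = x"
  unfolding phi_def by (rule inv_into_f_f) (auto simp: inj_on_def psi_eq_iff)

text \<open>
  The explicit inverse shows that \<open>psi a b\<close> attains every value in the open interval, so that
  \<open>phi a b\<close> is a right inverse there.
\<close>

lemma psi_ln:
  assumes "a < t" "t < b"
  shows "psi a b (ln ((t - a) / (b - t))) = t"
proof -
  let ?x = "ln ((t - a) / (b - t))"
  have e: "exp (- ?x) = (b - t) / (t - a)"
    using assms by (simp add: exp_minus)
  have "tanh (?x / 2) = (1 - exp (- ?x)) / (1 + exp (- ?x))"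
    by (subst tanh_real_altdef) simp
  also have "1 - exp (- ?x) = ((t - a) - (b - t)) / (t - a)"
    unfolding e using assms by (simp add: field_simps)
  also have "1 + exp (- ?x) = ((t - a) + (b - t)) / (t - a)"
    unfolding e using assms by (simp add: field_simps)
  finally have "tanh (?x / 2) = ((t - a) - (b - t)) / (b - a)"
    using assms by simp
  then have "(b - a) * tanh (?x / 2) = (t - a) - (b - t)"
    using assms by simp
  then show ?thesis
    unfolding psi_def by argo
qed

lemma psi_phi: "a < t \<Longrightarrow> t < b \<Longrightarrow> psi a b (phi a b t) = t"
  unfolding phi_def by (rule f_inv_into_f) (metis psi_ln rangeI)

text \<open>
  The behaviour of \<open>phi a b\<close> near \<open>a\<close> is read off from the monotonicity of \<open>psi a b\<close>: the points
  \<open>t\<close> with \<open>phi a b t < z\<close> fill a right neighbourhood of \<open>a\<close>, which ends at \<open>psi a b z\<close>.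
\<close>

lemma filterlim_phi_at_right:
  assumes "a < b"
  shows "filterlim (phi a b) at_bot (at_right a)"
proof (rule filterlim_at_bot[THEN iffD2], intro allI)
  fix z
  have "phi a b t \<le> z" if "a < t" "t < psi a b z" for t
  proof -
    have "psi a b (phi a b t) < psi a b z"
      using that psi_phi[of a t b] psi_bounds[OF assms, of z] by simp
    then show ?thesis by (simp add: psi_less_iff[OF assms])
  qed
  then show "\<forall>\<^sub>F t in at_right a. phi a b t \<le> z"
    using psi_bounds[OF assms, of z] by (auto simp: eventually_at_right)
qed

lemma comp_phi_node: "a < b \<Longrightarrow> comp_phi a b F (node a b h i) = F (of_int i * h)"
  using psi_bounds[of a b "of_int i * h"] by (simp add: comp_phi_def node_def phi_psi)

lemma node_eq_iff: "a < b \<Longrightarrow> h > 0 \<Longrightarrow> node a b h i = node a b h j \<longleftrightarrow> i = j"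
  by (simp add: node_def psi_eq_iff)

section \<open>Sinc functions and their integrals\<close>

lemma scaled_difference:
  fixes h :: real
  shows "h > 0 \<Longrightarrow> pi * (of_int i * h - of_int j * h) / h = pi * of_int (i - j)"
  by (simp add: field_simps)

lemma sinc_basis_kronecker:
  assumes "h > 0"
  shows "sinc_basis j h (of_int i * h) = (if i = j then 1 else 0)"
  unfolding sinc_basis_def scaled_difference[OF assms] sin_npi_int using assms by simp

lemma sinc_int_basis_node:
  "h > 0 \<Longrightarrow> sinc_int_basis j h (of_int i * h) = h * delta_int (i - j)"
  unfolding sinc_int_basis_def delta_int_def by (simp only: scaled_difference)

lemma sinc_basis_at_bot:
  assumes "h > 0"
  shows "(sinc_basis j h \<longlongrightarrow> 0) at_bot"
proof -
  have "filterlim (\<lambda>x::real. - of_int j * h + x) at_bot at_bot"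
    by (rule filterlim_tendsto_add_at_bot_iff[OF tendsto_const, THEN iffD2, OF filterlim_ident])
  then have "filterlim (\<lambda>x. (pi / h) * (- of_int j * h + x)) at_bot at_bot"
    by (rule filterlim_tendsto_pos_mult_at_bot[OF tendsto_const, rotated]) (use assms in simp)
  moreover have "(\<lambda>x. (pi / h) * (- of_int j * h + x)) = (\<lambda>x. pi * (x - of_int j * h) / h)"
    by (rule ext) simp
  ultimately have "filterlim (\<lambda>x. pi * (x - of_int j * h) / h) at_bot at_bot"
    by simp
  then have "((\<lambda>x. inverse (pi * (x - of_int j * h) / h)) \<longlongrightarrow> 0) at_bot"
    by (intro tendsto_inverse_0[THEN filterlim_compose])
       (auto intro: filterlim_mono[OF _ at_bot_le_at_infinity order_refl])
  then show ?thesis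
  proof (rule Lim_null_comparison[rotated, OF tendsto_rabs_zero])
    have "norm (sinc_basis j h x) \<le> \<bar>inverse (pi * (x - of_int j * h) / h)\<bar>"
      if "x < of_int j * h" for x
    proof -
      have "\<bar>sin (pi * (x - of_int j * h) / h)\<bar> * \<bar>inverse (pi * (x - of_int j * h) / h)\<bar>
          \<le> 1 * \<bar>inverse (pi * (x - of_int j * h) / h)\<bar>"
        by (rule mult_right_mono) auto
      then show ?thesis
        using that by (simp add: sinc_basis_def divide_inverse abs_mult)
    qed
    then show "\<forall>\<^sub>F x in at_bot.
        norm (sinc_basis j h x) \<le> \<bar>inverse (pi * (x - of_int j * h) / h)\<bar>"
      by (rule eventually_mono[OF eventually_gt_at_bot, rotated])
  qed
qed

lemma comp_phi_sinc_basis_left_end: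
  assumes "a < b" "h > 0"
  shows "comp_phi a b (sinc_basis j h) a = 0"
  using tendsto_Lim[OF trivial_limit_at_right_real
      filterlim_compose[OF sinc_basis_at_bot[OF assms(2)] filterlim_phi_at_right[OF assms(1)]]]
  by (simp add: comp_phi_def)

section \<open>Linear systems with symmetric index range\<close>

lemma entry_sym_vec: "i \<in> {- int N..int N} \<Longrightarrow> entry N (sym_vec N f) i = f i"
  unfolding entry_def sym_vec_def by (subst index_vec) auto

lemma sym_vec_carrier: "sym_vec N f \<in> carrier_vec (2*N+1)"
  by (simp add: sym_vec_def)

lemma sym_vec_cong:
  "sym_vec N f = sym_vec N f' \<longleftrightarrow> (\<forall>i\<in>{- int N..int N}. f i = f' i)"
  (is "?L \<longleftrightarrow> ?R")
proof
  assume ?L then show ?R by (metis entry_sym_vec)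
next
  assume ?R then show ?L by (auto simp: sym_vec_def)
qed

lemma sym_vec_entry: "x \<in> carrier_vec (2*N+1) \<Longrightarrow> sym_vec N (entry N x) = x"
  by (auto simp: sym_vec_def entry_def)

lemma sum_symmetric_index:
  "(\<Sum>q<2*N+1. f (int q - int N)) = (\<Sum>j\<in>{- int N..int N}. f j)"
  by (rule sum.reindex_bij_witness[of _ "\<lambda>j. nat (j + int N)" "\<lambda>q. int q - int N"]) auto

lemma sym_mat_mult_vec:
  assumes "x \<in> carrier_vec (2*N+1)"
  shows "sym_mat N A *\<^sub>v x = sym_vec N (\<lambda>i. \<Sum>j\<in>{- int N..int N}. A i j * entry N x j)"
proof (rule eq_vecI)
  fix p assume "p < dim_vec (sym_vec N (\<lambda>i. \<Sum>j\<in>{- int N..int N}. A i j * entry N x j))"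
  then have p: "p < 2*N+1" by (simp add: sym_vec_def)
  have "vec_index (sym_mat N A *\<^sub>v x) p
      = (\<Sum>q<2*N+1. A (int p - int N) (int q - int N) * entry N x (int q - int N))"
    using p assms
    by (auto simp: sym_mat_def scalar_prod_def entry_def atLeast0LessThan intro!: sum.cong)
  also have "\<dots> = (\<Sum>j\<in>{- int N..int N}. A (int p - int N) j * entry N x j)"
    by (rule sum_symmetric_index)
  finally show "vec_index (sym_mat N A *\<^sub>v x) p
      = vec_index (sym_vec N (\<lambda>i. \<Sum>j\<in>{- int N..int N}. A i j * entry N x j)) p"
    using p by (simp add: sym_vec_def)
qed (simp add: sym_mat_def sym_vec_def)

lemma sum_split_ends:
  fixes f :: "int \<Rightarrow> 'a::comm_monoid_add"
  assumes "N > 0"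
  shows "(\<Sum>j\<in>{- int N..int N}. f j)
    = f (- int N) + (\<Sum>j\<in>{- int N + 1..int N - 1}. f j) + f (int N)"
proof -
  have "{- int N..int N} = insert (- int N) (insert (int N) {- int N + 1..int N - 1})"
    using assms by auto
  then show ?thesis using assms by (simp add: ac_simps)
qed

lemma sum_kronecker:
  fixes f :: "int \<Rightarrow> real"
  shows "finite A \<Longrightarrow> (\<Sum>j\<in>A. f j * (if i = j then 1 else 0)) = (if i \<in> A then f i else 0)"
  by (simp add: if_distrib[of "\<lambda>x. _ * x"] cong: if_cong)

section \<open>Nodal values\<close>

lemma v_SE_node:
  assumes "a < b" "h > 0" "i \<in> {- int N..int N}"
  shows "v_SE a b N h u (node a b h i) = entry N u i"
  using assms by (simp add: v_SE_def comp_phi_node sinc_basis_kronecker sum_kronecker)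

lemma w_RZ_node:
  assumes "a < b" "h > 0"
  shows "w_RZ a b N h c (node a b h i) =
    entry N c (- int N) * omega_a a b (node a b h i)
    + (if i \<in> {- int N + 1..int N - 1} then entry N c i else 0)
    + entry N c (int N) * omega_b a b (node a b h i)"
  using assms by (simp add: w_RZ_def comp_phi_node sinc_basis_kronecker sum_kronecker)

lemma volterra_node:
  assumes "a < b" "h > 0"
  shows "volterra a b k N h f (node a b h i) =
    (\<Sum>j\<in>{- int N..int N}. k (node a b h i) (node a b h j) * deriv (psi a b) (of_int j * h) * h
        * delta_int (i - j) * f (node a b h j))"
  unfolding volterra_def
  by (rule sum.cong) (use assms in \<open>simp_all add: comp_phi_node sinc_int_basis_node\<close>)

lemma E_RZ_mult_vec:
  assumes "a < b" "h > 0" "N > 0" "c \<in> carrier_vec (2*N+1)"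
  shows "E_RZ a b N h *\<^sub>v c = sym_vec N (\<lambda>i. w_RZ a b N h c (node a b h i))"
  unfolding E_RZ_def sym_mat_mult_vec[OF assms(4)] sym_vec_cong
proof
  fix i
  have "(\<Sum>j\<in>{- int N + 1..int N - 1}.
      (if j = - int N then omega_a a b (node a b h i)
       else if j = int N then omega_b a b (node a b h i)
       else if i = j then 1 else 0) * entry N c j)
     = (\<Sum>j\<in>{- int N + 1..int N - 1}. entry N c j * (if i = j then 1 else 0))"
    by (rule sum.cong) auto
  then show "(\<Sum>j\<in>{- int N..int N}.
      (if j = - int N then omega_a a b (node a b h i)
       else if j = int N then omega_b a b (node a b h i)
       else if i = j then 1 else 0) * entry N c j) = w_RZ a b N h c (node a b h i)"
    unfolding sum_split_ends[OF assms(3)] w_RZ_node[OF assms(1,2)]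
    using assms(3) by (simp add: sum_kronecker)
qed

text \<open>
  Both sides list the nodal values of the discrete Volterra operator applied to \<open>w\<close>: on the left by
  linearity in the basis functions of \<open>w\<close>, on the right because the operator sees only the nodal
  values of its argument.
\<close>

lemma V_RZ_mult_vec:
  assumes "a < b" "h > 0" "N > 0" "c \<in> carrier_vec (2*N+1)"
  shows "V_RZ a b k N h *\<^sub>v c
    = V_SE a b k N h *\<^sub>v sym_vec N (\<lambda>i. w_RZ a b N h c (node a b h i))"
  unfolding V_RZ_def V_SE_def sym_mat_mult_vec[OF assms(4)] sym_mat_mult_vec[OF sym_vec_carrier]
    sym_vec_cong
proof
  fix i
  define K where "K j = k (node a b h i) (node a b h j)
      * deriv (psi a b) (of_int j * h) * h * delta_int (i - j)" for j
  let ?A = "volterra a b k N h (omega_a a b) (node a b h i)"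
  let ?B = "volterra a b k N h (omega_b a b) (node a b h i)"
  let ?inner = "\<lambda>j. if j \<in> {- int N + 1..int N - 1} then entry N c j else 0"
  have vol: "volterra a b k N h f (node a b h i)
      = (\<Sum>j\<in>{- int N..int N}. K j * f (node a b h j))" for f
    unfolding K_def by (rule volterra_node[OF assms(1,2)])
  have "(\<Sum>j\<in>{- int N + 1..int N - 1}.
      (if j = - int N then ?A else if j = int N then ?B else K j) * entry N c j)
     = (\<Sum>j\<in>{- int N + 1..int N - 1}. K j * ?inner j)"
    by (rule sum.cong) auto
  then have "(\<Sum>j\<in>{- int N..int N}.
      (if j = - int N then ?A else if j = int N then ?B else K j) * entry N c j)
     = ?A * entry N c (- int N) + (\<Sum>j\<in>{- int N..int N}. K j * ?inner j)
       + ?B * entry N c (int N)"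
    unfolding sum_split_ends[OF assms(3)] using assms(3) by simp
  also have "\<dots> = (\<Sum>j\<in>{- int N..int N}. K j * w_RZ a b N h c (node a b h j))"
    unfolding vol w_RZ_node[OF assms(1,2)] sum_distrib_right sum.distrib[symmetric]
    by (rule sum.cong) (simp_all only: algebra_simps)
  also have "\<dots> = (\<Sum>j\<in>{- int N..int N}.
      K j * entry N (sym_vec N (\<lambda>i. w_RZ a b N h c (node a b h i))) j)"
    by (rule sum.cong) (simp_all only: entry_sym_vec)
  finally show "(\<Sum>j\<in>{- int N..int N}.
      (if j = - int N then ?A else if j = int N then ?B else k (node a b h i) (node a b h j)
        * deriv (psi a b) (of_int j * h) * h * delta_int (i - j)) * entry N c j)
    = (\<Sum>j\<in>{- int N..int N}. k (node a b h i) (node a b h j)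
        * deriv (psi a b) (of_int j * h) * h * delta_int (i - j)
        * entry N (sym_vec N (\<lambda>i. w_RZ a b N h c (node a b h i))) j)"
    unfolding K_def .
qed

lemma coefficient_matrix_carriers:
  "V_SE a b k N h \<in> carrier_mat (2*N+1) (2*N+1)"
  "E_RZ a b N h \<in> carrier_mat (2*N+1) (2*N+1)"
  "V_RZ a b k N h \<in> carrier_mat (2*N+1) (2*N+1)"
  by (simp_all add: V_SE_def E_RZ_def V_RZ_def sym_mat_def)

text \<open>
  The link between the two systems, valid for every coefficient vector \<open>c\<close>: the nodal values of \<open>w\<close>
  have the same residual in the one system as \<open>c\<close> has in the other.
\<close>

lemma SE_residual_of_RZ_nodal_values:
  assumes "a < b" "h > 0" "N > 0" "c \<in> carrier_vec (2*N+1)"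
  shows "(1\<^sub>m (2*N+1) - V_SE a b k N h) *\<^sub>v sym_vec N (\<lambda>i. w_RZ a b N h c (node a b h i))
    = (E_RZ a b N h - V_RZ a b k N h) *\<^sub>v c"
  using minus_mult_distrib_mat_vec[OF one_carrier_mat coefficient_matrix_carriers(1) sym_vec_carrier]
    minus_mult_distrib_mat_vec[OF coefficient_matrix_carriers(2,3) assms(4)]
    E_RZ_mult_vec[OF assms] V_RZ_mult_vec[OF assms] one_mult_mat_vec[OF sym_vec_carrier]
  by metis

lemma nodal_values_coincide:
  assumes "admissible a b g k N h u c" "i \<in> {- int N..int N}"
  shows "v_SE a b N h u (node a b h i) = w_RZ a b N h c (node a b h i)"
proof -
  let ?d = "sym_vec N (\<lambda>i. w_RZ a b N h c (node a b h i))"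
  have ab: "a < b" and h: "h > 0" and N: "N > 0"
    and u: "uniquely_solved_by (1\<^sub>m (2*N+1) - V_SE a b k N h) (g_vec a b g N h) u"
    and c: "uniquely_solved_by (E_RZ a b N h - V_RZ a b k N h) (g_vec a b g N h) c"
    using assms(1) by (auto simp: admissible_def)
  have dims: "dim_col (1\<^sub>m (2*N+1) - V_SE a b k N h) = 2*N+1"
      "dim_col (E_RZ a b N h - V_RZ a b k N h) = 2*N+1"
    using coefficient_matrix_carriers(1,3)[of a b k N h] by auto
  have "(1\<^sub>m (2*N+1) - V_SE a b k N h) *\<^sub>v ?d = g_vec a b g N h"
    using c SE_residual_of_RZ_nodal_values[OF ab h N, of c k] dims
    unfolding uniquely_solved_by_def by metis
  then have "?d = u"
    using u dims sym_vec_carrier unfolding uniquely_solved_by_def by metis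
  then show ?thesis
    using v_SE_node[OF ab h assms(2)] entry_sym_vec[OF assms(2)] by metis
qed

section \<open>Values at the left endpoint\<close>

lemma v_SE_left_end:
  "a < b \<Longrightarrow> h > 0 \<Longrightarrow> v_SE a b N h u a = entry N u (- int N)"
  by (simp add: v_SE_def comp_phi_sinc_basis_left_end omega_a_def omega_b_def)

lemma w_RZ_left_end:
  "a < b \<Longrightarrow> h > 0 \<Longrightarrow> w_RZ a b N h c a = entry N c (- int N)"
  by (simp add: w_RZ_def comp_phi_sinc_basis_left_end omega_a_def omega_b_def)

section \<open>The zero kernel\<close>

lemma affine_eq_of_two_points:
  assumes "a < b" "p \<noteq> q"
    and "x * omega_a a b p + y * omega_b a b p = x' * omega_a a b p + y' * omega_b a b p"
    and "x * omega_a a b q + y * omega_b a b q = x' * omega_a a b q + y' * omega_b a b q"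
  shows "x = x'" "y = y'"
proof -
  have zero: "(x - x') * (b - r) + (y - y') * (r - a) = 0"
    if "x * omega_a a b r + y * omega_b a b r = x' * omega_a a b r + y' * omega_b a b r" for r
  proof -
    have "(x * (b - r) + y * (r - a)) / (b - a) = (x' * (b - r) + y' * (r - a)) / (b - a)"
      using that by (simp add: omega_a_def omega_b_def add_divide_distrib)
    then show ?thesis using assms(1) by (simp add: algebra_simps)
  qed
  \<comment> \<open>The difference of the affine functions has slope proportional to this first factor.\<close>
  have "((y - y') - (x - x')) * (p - q) = 0"
    using zero[OF assms(3)] zero[OF assms(4)] by (simp add: algebra_simps)
  then have eq: "y - y' = x - x'" using assms(2) by simp
  have "(x - x') * (b - a) = 0"
    using zero[OF assms(3)] unfolding eq by (simp add: algebra_simps)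
  then show "x = x'" using assms(1) by simp
  then show "y = y'" using eq by simp
qed

text \<open>
  In view of \<open>E_RZ_mult_vec\<close> this is the injectivity of \<open>E\<^sup>R\<^sup>Z\<close>. At the two extreme nodes \<open>w\<close> equals
  its affine part, and two points determine an affine function; the inner coefficients are then the
  remaining nodal values.
\<close>

lemma w_RZ_nodes_inject:
  assumes "a < b" "h > 0" "N > 0"
    and "c \<in> carrier_vec (2*N+1)" "c' \<in> carrier_vec (2*N+1)"
    and eq: "\<And>i. i \<in> {- int N..int N} \<Longrightarrow>
      w_RZ a b N h c (node a b h i) = w_RZ a b N h c' (node a b h i)"
  shows "c = c'"
proof -
  note w = w_RZ_node[OF assms(1,2)]
  have distinct: "node a b h (- int N) \<noteq> node a b h (int N)"
    using assms(3) by (simp add: node_eq_iff[OF assms(1,2)])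
  \<comment> \<open>At the two extreme nodes the inner basis functions vanish.\<close>
  have affine: "entry N c (- int N) * omega_a a b (node a b h i)
        + entry N c (int N) * omega_b a b (node a b h i)
      = entry N c' (- int N) * omega_a a b (node a b h i)
        + entry N c' (int N) * omega_b a b (node a b h i)"
    if "i = - int N \<or> i = int N" for i
    using eq[of i] that unfolding w by auto
  note ends = affine_eq_of_two_points[OF assms(1) distinct
      affine[OF disjI1[OF refl]] affine[OF disjI2[OF refl]]]
  have "entry N c i = entry N c' i" if "i \<in> {- int N..int N}" for i
  proof (cases "i \<in> {- int N + 1..int N - 1}")
    case True
    then show ?thesis using eq[OF that] unfolding w by (simp add: ends)
  next
    case False
    then have "i = - int N \<or> i = int N" using that by auto
    then show ?thesis using ends by auto
  qed
  then have "sym_vec N (entry N c) = sym_vec N (entry N c')"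
    by (simp add: sym_vec_cong)
  then show ?thesis
    unfolding sym_vec_entry[OF assms(4)] sym_vec_entry[OF assms(5)] .
qed

text \<open>
  For the zero kernel the two systems read \<open>u = g\<close> and \<open>E\<^sup>R\<^sup>Z c = g\<close>. With \<open>g = \<omega>\<^sub>a\<close>, the first
  basis function of \<open>w\<close>, the second one is solved by the first unit vector.
\<close>

lemma admissible_zero_kernel:
  assumes "a < b" "h > 0" "N > 0"
  shows "admissible a b (omega_a a b) (\<lambda>_ _. 0) N h
    (sym_vec N (\<lambda>i. omega_a a b (node a b h i))) (sym_vec N (\<lambda>i. if i = - int N then 1 else 0))"
    (is "admissible _ _ _ _ _ _ ?u ?c")
proof -
  have cont: "continuous_on {a..b} (omega_a a b)"
    unfolding omega_a_def using assms(1) by (intro continuous_intros) auto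
  have volterra0: "volterra a b (\<lambda>_ _. 0) N h f t = 0" for f t
    by (simp add: volterra_def)
  have V: "V_SE a b (\<lambda>_ _. 0) N h = 0\<^sub>m (2*N+1) (2*N+1)"
      "V_RZ a b (\<lambda>_ _. 0) N h = 0\<^sub>m (2*N+1) (2*N+1)"
    by (auto simp: V_SE_def V_RZ_def sym_mat_def volterra0)
  have minus0: "1\<^sub>m (2*N+1) - 0\<^sub>m (2*N+1) (2*N+1) = (1\<^sub>m (2*N+1) :: real mat)"
      "E_RZ a b N h - 0\<^sub>m (2*N+1) (2*N+1) = E_RZ a b N h"
    by (auto simp: E_RZ_def sym_mat_def)
  have dim: "dim_col (E_RZ a b N h) = 2*N+1"
    by (simp add: E_RZ_def sym_mat_def)
  have u: "uniquely_solved_by (1\<^sub>m (2*N+1)) (g_vec a b (omega_a a b) N h) ?u"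
    unfolding uniquely_solved_by_def g_vec_def by (simp add: sym_vec_def)
  have wc: "w_RZ a b N h ?c (node a b h i) = omega_a a b (node a b h i)"
    if "i \<in> {- int N..int N}" for i
    using that assms by (auto simp: w_RZ_node entry_sym_vec)
  have "E_RZ a b N h *\<^sub>v ?c = g_vec a b (omega_a a b) N h"
    unfolding E_RZ_mult_vec[OF assms sym_vec_carrier] g_vec_def sym_vec_cong using wc by blast
  moreover have "x = ?c"
    if x: "x \<in> carrier_vec (2*N+1)" and "E_RZ a b N h *\<^sub>v x = g_vec a b (omega_a a b) N h" for x
  proof (rule w_RZ_nodes_inject[OF assms x sym_vec_carrier])
    fix i assume i: "i \<in> {- int N..int N}"
    have "w_RZ a b N h x (node a b h i) = omega_a a b (node a b h i)"
      using that(2) i unfolding E_RZ_mult_vec[OF assms x] g_vec_def sym_vec_cong by blast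
    then show "w_RZ a b N h x (node a b h i) = w_RZ a b N h ?c (node a b h i)"
      using wc[OF i] by simp
  qed
  ultimately have c: "uniquely_solved_by (E_RZ a b N h) (g_vec a b (omega_a a b) N h) ?c"
    unfolding uniquely_solved_by_def dim using sym_vec_carrier by blast
  show ?thesis
    unfolding admissible_def V minus0 using assms cont u c by simp
qed

theorem theorem4p2:
  shows "(\<forall>a b g k N h u c. admissible a b g k N h u c \<longrightarrow>
            (\<forall>i\<in>{- int N..int N}. v_SE a b N h u (node a b h i) = w_RZ a b N h c (node a b h i)))
       \<and> \<not> (\<forall>a b g k N h u c. admissible a b g k N h u c \<longrightarrow>
            (\<forall>t\<in>{a..b}. v_SE a b N h u t = w_RZ a b N h c t))"
proof (intro conjI notI)
  show "\<forall>a b g k N h u c. admissible a b g k N h u c \<longrightarrow>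
      (\<forall>i\<in>{- int N..int N}. v_SE a b N h u (node a b h i) = w_RZ a b N h c (node a b h i))"
    using nodal_values_coincide by blast
next
  \<comment> \<open>The smallest instance of \<open>admissible_zero_kernel\<close>: the interval \<open>[0, 1]\<close> with \<open>h = N = 1\<close>.\<close>
  define u where "u = sym_vec 1 (\<lambda>i. omega_a 0 1 (node 0 1 1 i))"
  define c where "c = sym_vec 1 (\<lambda>i. if i = - int 1 then 1 else (0::real))"
  assume "\<forall>a b g k N h u c. admissible a b g k N h u c \<longrightarrow>
      (\<forall>t\<in>{a..b}. v_SE a b N h u t = w_RZ a b N h c t)"
  moreover have "admissible 0 1 (omega_a 0 1) (\<lambda>_ _. 0) 1 1 u c"
    unfolding u_def c_def by (rule admissible_zero_kernel) simp_all
  ultimately have "v_SE 0 1 1 1 u 0 = w_RZ 0 1 1 1 c 0"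
    by force
  then have "omega_a 0 1 (node 0 1 1 (-1)) = 1"
    by (simp add: v_SE_left_end w_RZ_left_end u_def c_def entry_sym_vec)
  moreover have "node 0 1 1 (-1) > 0"
    unfolding node_def by (rule psi_bounds) simp
  ultimately show False by (simp add: omega_a_def)
qed

end
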